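(* Let $(M;\vee,\wedge,\oplus,0)$ be an EMV-algebra and let $(N;\vee,\wedge,\oplus,0)$ be its representing EMV-algebra with top element (with $M$ identified with its image in $N$). If $R:N\to N$ is a square root on $N$, then the restriction $r:=R|_M$ is a square root on $M$ (in particular it maps $M$ into $M$).
   Context: An EMV-algebra is an algebra $(M;\vee,\wedge,\oplus,0)$ of type $(2,2,2,0)$ such that: (E1) $(M;\vee,\wedge,0)$ is a distributive lattice with least element $0$; (E2) $(M;\oplus,0)$ is a commutative ordered monoid with neutral element $0$; (E3) writing $\mathcal I(M)=\{x\in M\mid x\oplus x=x\}$ (the idempotents), for each $a\in\mathcal I(M)$ and each $x\in[0,a]$ the element $\lambda_a(x)=\min\{z\in[0,a]\mid x\oplus z=a\}$ exists, and $([0,a];\oplus,\lambda_a,0,a)$ is an MV-algebra; (E4) for each $x\in M$ there is $a\in\mathcal I(M)$ with $x\le a$. A top element is not assumed. For $x,y\in M$, $x\odot y:=\lambda_a(\lambda_a(x)\oplus\lambda_a(y))$ for any $a\in\mathcal I(M)$ with $x,y\le a$ (this does not depend on $a$). A square root on $M$ is a map $s:M\to M$ such that (Sq1) $s(x)\odot s(x)=x$ for all $x\in M$; (Sq2) for all $x,y\in M$, $y\odot y\le x$ implies $y\le s(x)$. Representing EMV-algebra: if $M$ has a top element, then $N=M$. If $M$ has no top element, then $N$ is the (unique up to isomorphism) EMV-algebra with top element $1$ (equivalently, MV-algebra with $x'=\lambda_1(x)$) into which $M$ embeds as a maximal ideal such that every element of $N$ is either (the image of) an element of $M$ or the complement $x'$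 of (the image of) an element $x$ of $M$; existence and uniqueness are known. *)

theory Defs
  imports Main
begin

locale mv_algebra =
  fixes A :: "'a set" and add :: "'a \<Rightarrow> 'a \<Rightarrow> 'a" and neg :: "'a \<Rightarrow> 'a"
    and zero :: 'a and one :: 'a
  assumes zero_closed: "zero \<in> A"
    and one_closed: "one \<in> A"
    and add_closed: "\<lbrakk>x \<in> A; y \<in> A\<rbrakk> \<Longrightarrow> add x y \<in> A"
    and neg_closed: "x \<in> A \<Longrightarrow> neg x \<in> A"
    and add_assoc: "\<lbrakk>x \<in> A; y \<in> A; z \<in> A\<rbrakk> \<Longrightarrow> add (add x y) z = add x (add y z)"
    and add_commute: "\<lbrakk>x \<in> A; y \<in> A\<rbrakk> \<Longrightarrow> add x y = add y x"
    and add_zero: "x \<in> A \<Longrightarrow> add x zero = x"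
    and neg_neg: "x \<in> A \<Longrightarrow> neg (neg x) = x"
    and neg_zero: "neg zero = one"
    and add_one: "x \<in> A \<Longrightarrow> add x one = one"
    and lukasiewicz: "\<lbrakk>x \<in> A; y \<in> A\<rbrakk> \<Longrightarrow>
      add (neg (add (neg x) y)) y = add (neg (add (neg y) x)) x"

text \<open>
  The type class operations \<open>sup\<close>, \<open>inf\<close>, \<open>+\<close> and \<open>0\<close> play the roles of \<open>\<or>\<close>, \<open>\<and>\<close>, \<open>\<oplus>\<close> and
  \<open>0\<close>. The following auxiliary class consists of (E1) and (E2); the monoid order is the lattice
  order because both superclasses share \<open>\<le>\<close>.
\<close>

class emv_base = distrib_lattice + ordered_comm_monoid_add +
  assumes zero_least: "0 \<le> x"
begin

definition emv_idem :: "'a \<Rightarrow> bool" where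
  "emv_idem a \<longleftrightarrow> a + a = a"

text \<open>
  \<open>emv_neg a x\<close> is \<open>\<lambda>\<^sub>a(x)\<close>. It is meaningful only for idempotent \<open>a\<close> and \<open>x \<le> a\<close>, where the
  minimum exists by (E3); every element is \<open>\<ge> 0\<close>, so \<open>[0,a]\<close> is \<open>{z. z \<le> a}\<close>.
\<close>

definition emv_neg :: "'a \<Rightarrow> 'a \<Rightarrow> 'a" where
  "emv_neg a x = (LEAST z. z \<le> a \<and> x + z = a)"

end

class emv_algebra = emv_base +
  assumes neg_exists: "\<lbrakk>emv_idem a; x \<le> a\<rbrakk> \<Longrightarrow>
      \<exists>z. (z \<le> a \<and> x + z = a) \<and> (\<forall>w. w \<le> a \<and> x + w = a \<longrightarrow> z \<le> w)"
    and mv_interval: "emv_idem a \<Longrightarrow> mv_algebra {0..a} (+) (emv_neg a) 0 a"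
    and idem_above: "\<exists>a. emv_idem a \<and> x \<le> a"
begin

text \<open>The value of \<open>x \<odot> y\<close> does not depend on the chosen idempotent upper bound \<open>a\<close>.\<close>

definition emv_odot :: "'a \<Rightarrow> 'a \<Rightarrow> 'a"  (infixl \<open>\<odot>\<close> 70) where
  "x \<odot> y = (let a = (SOME a. emv_idem a \<and> x \<le> a \<and> y \<le> a)
             in emv_neg a (emv_neg a x + emv_neg a y))"

definition emv_square_root :: "('a \<Rightarrow> 'a) \<Rightarrow> bool" where
  "emv_square_root s \<longleftrightarrow>
     (\<forall>x. s x \<odot> s x = x) \<and> (\<forall>x y. y \<odot> y \<le> x \<longrightarrow> y \<le> s x)"

definition emv_is_top :: "'a \<Rightarrow> bool" where
  "emv_is_top t \<longleftrightarrow> (\<forall>x. x \<le> t)"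

definition emv_ideal :: "'a set \<Rightarrow> bool" where
  "emv_ideal I \<longleftrightarrow> I \<noteq> {} \<and> (\<forall>x y. y \<in> I \<and> x \<le> y \<longrightarrow> x \<in> I) \<and> (\<forall>x\<in>I. \<forall>y\<in>I. x + y \<in> I)"

definition emv_maximal_ideal :: "'a set \<Rightarrow> bool" where
  "emv_maximal_ideal I \<longleftrightarrow>
     emv_ideal I \<and> I \<noteq> UNIV \<and> (\<forall>J. emv_ideal J \<and> J \<noteq> UNIV \<and> I \<subseteq> J \<longrightarrow> J = I)"

end

text \<open>
  An embedding is an injective homomorphism for the signature \<open>(\<or>, \<and>, \<oplus>, 0)\<close>. Compatibility with
  the maps \<open>\<lambda>\<^sub>a\<close> is not demanded; it follows when the image is downward closed, as it is below.
\<close>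

definition emv_embedding :: "('a::emv_algebra \<Rightarrow> 'b::emv_algebra) \<Rightarrow> bool" where
  "emv_embedding f \<longleftrightarrow> inj f \<and> f 0 = 0 \<and> (\<forall>x y. f (x + y) = f x + f y) \<and>
     (\<forall>x y. f (sup x y) = sup (f x) (f y)) \<and> (\<forall>x y. f (inf x y) = inf (f x) (f y))"

text \<open>
  \<open>representing_emv \<iota>\<close>: the codomain is the representing EMV-algebra of the domain, with \<open>\<iota>\<close> as the
  identification of the domain with a subalgebra. If the domain has a top element, \<open>N = M\<close> is
  rendered as \<open>\<iota>\<close> being an isomorphism.
\<close>

definition representing_emv :: "('a::emv_algebra \<Rightarrow> 'b::emv_algebra) \<Rightarrow> bool" where
  "representing_emv \<iota> \<longleftrightarrow> emv_embedding \<iota> \<and>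
     (if \<exists>t::'a. emv_is_top t then surj \<iota>
      else emv_maximal_ideal (range \<iota>) \<and>
        (\<exists>u::'b. emv_is_top u \<and> (\<forall>y. y \<in> range \<iota> \<or> (\<exists>x. y = emv_neg u (\<iota> x)))))"

end

(*
  Suppose M has no top; let u be the top of N and x in M. If R(x) were not in M, then R(x) = y'
  for some y in M, so x = y' \<odot> y' = (y + y)' and hence u = x + (y + y) would lie in M, which
  is a proper ideal.
  Since M is downward closed in N, the relative negations of M and N agree, hence so do the
  products, and both square root axioms restrict from N to M.
*)
theory Submission imports Defs begin

context emv_algebra
begin

section \<open>Arithmetic inside one interval [0,a] below an idempotent\<close>

context
  fixes a
  assumes idem: "emv_idem a"
begin

interpretation mv: mv_algebra "{0..a}" "(+)" "emv_neg a" 0 a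
  by (rule mv_interval[OF idem])

lemma emv_neg_le: "x \<le> a \<Longrightarrow> emv_neg a x \<le> a"
  using mv.neg_closed[of x] zero_least by simp

lemma add_le_idem: "x \<le> a \<Longrightarrow> y \<le> a \<Longrightarrow> x + y \<le> a"
  using mv.add_closed[of x y] zero_least by simp

lemma emv_neg_neg: "x \<le> a \<Longrightarrow> emv_neg a (emv_neg a x) = x"
  using mv.neg_neg[of x] zero_least by simp

lemma add_idem: "x \<le> a \<Longrightarrow> x + a = a"
  using mv.add_one[of x] zero_least by simp

lemma emv_neg_least:
  assumes "x \<le> a"
  shows "x + emv_neg a x = a" and "\<lbrakk>w \<le> a; x + w = a\<rbrakk> \<Longrightarrow> emv_neg a x \<le> w"
proof -
  obtain z where z: "z \<le> a \<and> x + z = a" and min: "\<And>w. w \<le> a \<and> x + w = a \<Longrightarrow> z \<le> w"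
    using neg_exists[OF idem assms] by blast
  have "emv_neg a x = z"
    unfolding emv_neg_def using z min by (rule Least_equality)
  then show "x + emv_neg a x = a" and "\<lbrakk>w \<le> a; x + w = a\<rbrakk> \<Longrightarrow> emv_neg a x \<le> w"
    using z min by auto
qed

text \<open>By minimality, \<open>x\<close> is the least complement of \<open>emv_neg a x\<close>;
  so any \<open>y\<close> completing \<open>emv_neg a x\<close> to \<open>a\<close> lies above
  it.\<close>

lemma le_iff_neg_add:
  assumes "x \<le> a" "y \<le> a"
  shows "x \<le> y \<longleftrightarrow> emv_neg a x + y = a"
proof
  assume "x \<le> y"
  then have "emv_neg a x + x \<le> emv_neg a x + y"
    by (rule add_left_mono)
  then show "emv_neg a x + y = a"
    using emv_neg_least(1)[OF assms(1)] add_le_idem[OF emv_neg_le[OF assms(1)] assms(2)]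
    by (simp add: add_commute antisym)
next
  assume "emv_neg a x + y = a"
  then show "x \<le> y"
    using emv_neg_least(2)[OF emv_neg_le[OF assms(1)] assms(2)] emv_neg_neg[OF assms(1)] by simp
qed

text \<open>Truncated subtraction of \<open>x\<close> is left adjoint to addition of
  \<open>x\<close>: both sides unfold to \<open>emv_neg a t + x + v = a\<close>.\<close>

lemma residuation:
  assumes "t \<le> a" "x \<le> a" "v \<le> a"
  shows "emv_neg a (emv_neg a t + x) \<le> v \<longleftrightarrow> t \<le> x + v"
proof -
  have le: "emv_neg a t + x \<le> a"
    using assms by (simp add: emv_neg_le add_le_idem)
  have "emv_neg a (emv_neg a t + x) \<le> v \<longleftrightarrow> (emv_neg a t + x) + v = a"
    using le_iff_neg_add[OF emv_neg_le[OF le] assms(3)] emv_neg_neg[OF le] by simp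
  then show ?thesis
    using assms by (simp add: le_iff_neg_add add_le_idem add_assoc)
qed

text \<open>By residuation, adding \<open>x\<close> is a right adjoint on [0,a], hence preserves
  meets.\<close>

lemma add_inf_distrib:
  assumes "x \<le> a" "y \<le> a" "z \<le> a"
  shows "x + inf y z = inf (x + y) (x + z)"
proof (rule order.antisym)
  show "x + inf y z \<le> inf (x + y) (x + z)"
    by (simp add: add_left_mono)
  define t where "t = inf (x + y) (x + z)"
  have "inf y z \<le> a" "t \<le> a"
    using assms add_le_idem[OF assms(1,2)] unfolding t_def by (auto intro: le_infI1)
  moreover have "t \<le> x + y" "t \<le> x + z"
    unfolding t_def by auto
  ultimately show "inf (x + y) (x + z) \<le> x + inf y z"
    unfolding t_def[symmetric] using assms by (simp flip: residuation)
qed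

text \<open>Idempotents are Boolean elements of [0,a]: an element \<open>w\<close> below both
  \<open>b\<close> and its complement is absorbed by \<open>b\<close>, and this forces
  \<open>emv_neg a w = a\<close>.\<close>

lemma inf_emv_neg_idem:
  assumes b: "emv_idem b" "b \<le> a"
  shows "inf (emv_neg a b) b = 0"
proof -
  define w where "w = inf (emv_neg a b) b"
  have w: "w \<le> emv_neg a b" "w \<le> b" "w \<le> a"
    using b unfolding w_def by (auto intro: le_infI2)
  have wb: "w + b = b"
    using add_right_mono[OF w(2), of b] add_right_mono[OF zero_least, of b w] b(1)
    by (simp add: emv_idem_def order.antisym)
  have bw: "emv_neg a b + emv_neg a w = a"
    using w b by (simp add: le_iff_neg_add emv_neg_le add_commute)
  \<comment> \<open>The left side collapses to \<open>a\<close> because \<open>w + b = b\<close>,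
    the right side to \<open>emv_neg a w\<close> because \<open>bw\<close> makes its first summand
    0.\<close>
  have "emv_neg a (emv_neg a (emv_neg a w) + b) + b =
      emv_neg a (emv_neg a b + emv_neg a w) + emv_neg a w"
    using mv.lukasiewicz[of "emv_neg a w" b] w b zero_least by (simp add: emv_neg_le)
  then have "a = emv_neg a w"
    using wb bw w b emv_neg_least(1)[of b] mv.neg_neg[OF mv.zero_closed] mv.neg_zero
    by (simp add: emv_neg_neg add_commute)
  then show ?thesis
    using emv_neg_neg[OF w(3)] mv.neg_neg[OF mv.zero_closed] mv.neg_zero w_def by simp
qed

end

section \<open>Changing the interval, and independence of the product from it\<close>

lemma emv_neg_subinterval:
  assumes a: "emv_idem a" and b: "emv_idem b" "b \<le> a" and x: "x \<le> b"
  shows "emv_neg b x \<le> emv_neg a x" and "emv_neg a x \<le> emv_neg b x + emv_neg a b"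
proof -
  note x' = order.trans[OF x b(2)]
  note neg = emv_neg_least(1)[OF b(1) x] emv_neg_least(1)[OF a x'] emv_neg_least(1)[OF a b(2)]
  \<comment> \<open>Cutting the larger negation down to [0,b] leaves a complement of
    \<open>x\<close> there, so the minimal one lies below it.\<close>
  have "x + inf (emv_neg a x) b = inf (x + emv_neg a x) (x + b)"
    using add_inf_distrib[OF a] x' b emv_neg_le[OF a x'] by simp
  also have "\<dots> = b"
    using neg add_idem[OF b(1) x] b(2) by (simp add: inf.absorb2)
  finally have "emv_neg b x \<le> inf (emv_neg a x) b"
    by (intro emv_neg_least(2)[OF b(1) x]) auto
  then show "emv_neg b x \<le> emv_neg a x"
    by simp
  \<comment> \<open>Conversely, the smaller negation becomes a complement in [0,a] once the gap
    \<open>emv_neg a b\<close> is added.\<close>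
  have "x + (emv_neg b x + emv_neg a b) = a"
    using neg by (simp flip: add_assoc)
  moreover have "emv_neg b x + emv_neg a b \<le> a"
    using emv_neg_le[OF b(1) x] emv_neg_le[OF a b(2)] b(2) by (intro add_le_idem[OF a]) auto
  ultimately show "emv_neg a x \<le> emv_neg b x + emv_neg a b"
    using emv_neg_least(2)[OF a x'] by blast
qed

text \<open>The two negations differ by at most \<open>emv_neg a b\<close>, which is disjoint from
  \<open>b\<close> and hence invisible to elements \<open>x\<close> below \<open>b\<close>.\<close>

lemma le_emv_neg_add_subinterval:
  assumes a: "emv_idem a" and b: "emv_idem b" "b \<le> a" and le: "x \<le> b" "y \<le> b" "z \<le> b"
  shows "x \<le> emv_neg a y + z \<longleftrightarrow> x \<le> emv_neg b y + z"
proof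
  assume "x \<le> emv_neg b y + z"
  also have "\<dots> \<le> emv_neg a y + z"
    using emv_neg_subinterval(1)[OF a b le(2)] by (rule add_right_mono)
  finally show "x \<le> emv_neg a y + z" .
next
  define t where "t = emv_neg b y + z"
  have t: "t \<le> b"
    unfolding t_def using le by (simp add: add_le_idem[OF b(1)] emv_neg_le[OF b(1)])
  assume "x \<le> emv_neg a y + z"
  also have "\<dots> \<le> (emv_neg b y + emv_neg a b) + z"
    using emv_neg_subinterval(2)[OF a b le(2)] by (rule add_right_mono)
  also have "\<dots> = t + emv_neg a b"
    by (simp add: t_def add_ac)
  \<comment> \<open>The second bound is just \<open>x \<le> b\<close>, since
    \<open>t + b = b\<close>; in this form distributivity can isolate the meet that
    vanishes.\<close>
  finally have "x \<le> inf (t + emv_neg a b) (t + b)"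
    using le(1) add_idem[OF b(1) t] by simp
  also have "\<dots> = t + inf (emv_neg a b) b"
    using t b emv_neg_le[OF a b(2)] by (subst add_inf_distrib[OF a]) auto
  finally show "x \<le> emv_neg b y + z"
    using inf_emv_neg_idem[OF a b] by (simp add: t_def)
qed

text \<open>By residuation both products have the same upper bounds within [0,b]. Testing first with
  \<open>?pb\<close> shows that \<open>?pa\<close> lies in [0,b] too, so it can serve as the second
  test.\<close>

lemma emv_odot_subinterval:
  assumes a: "emv_idem a" and b: "emv_idem b" "b \<le> a" and le: "x \<le> b" "y \<le> b"
  shows "emv_neg a (emv_neg a x + emv_neg a y) = emv_neg b (emv_neg b x + emv_neg b y)"
    (is "?pa = ?pb")
proof -
  have le_a: "x \<le> a" "y \<le> a"
    using le b(2) by auto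
  have "?pb \<le> b"
    using le by (simp add: b(1) emv_neg_le add_le_idem)
  have iff: "?pa \<le> z \<longleftrightarrow> ?pb \<le> z" if "z \<le> b" for z
    using le le_a that b order.trans[OF that b(2)] le_emv_neg_add_subinterval[OF a b le that]
    by (simp add: residuation a emv_neg_le)
  from iff[OF \<open>?pb \<le> b\<close>] have "?pa \<le> ?pb"
    by simp
  with iff[of ?pa] \<open>?pb \<le> b\<close> show ?thesis
    by (simp add: order.antisym)
qed

text \<open>The bound picked by \<open>SOME\<close> and the given \<open>a\<close> may be
  incomparable; both are compared with an idempotent \<open>c\<close> above their join.\<close>

lemma emv_odot_eq:
  assumes a: "emv_idem a" "x \<le> a" "y \<le> a"
  shows "x \<odot> y = emv_neg a (emv_neg a x + emv_neg a y)"
proof -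
  define b where "b = (SOME b. emv_idem b \<and> x \<le> b \<and> y \<le> b)"
  have b: "emv_idem b \<and> x \<le> b \<and> y \<le> b"
    unfolding b_def by (rule someI[of _ a]) (use a in simp)
  obtain c where c: "emv_idem c" "sup a b \<le> c"
    using idem_above by blast
  show ?thesis
    using emv_odot_subinterval[OF c(1), of a x y] emv_odot_subinterval[OF c(1), of b x y] a b c(2)
    by (simp add: emv_odot_def b_def[symmetric])
qed

end

section \<open>Embeddings with downward closed image\<close>

locale emv_ideal_embedding =
  fixes f :: "'a::emv_algebra \<Rightarrow> 'b::emv_algebra"
  assumes embedding: "emv_embedding f"
    and down_closed: "y \<le> f x \<Longrightarrow> y \<in> range f"
begin

lemma map_add: "f (x + y) = f x + f y"
  using embedding by (simp add: emv_embedding_def)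

lemma map_eq_iff: "f x = f y \<longleftrightarrow> x = y"
  using embedding by (simp add: emv_embedding_def inj_eq)

lemma map_le_iff: "f x \<le> f y \<longleftrightarrow> x \<le> y"
  using embedding map_eq_iff unfolding emv_embedding_def by (metis inf.absorb_iff1)

lemma map_idem_iff: "emv_idem (f a) \<longleftrightarrow> emv_idem a"
  by (simp add: emv_idem_def map_eq_iff flip: map_add)

text \<open>The negation taken in the codomain lies below \<open>f a\<close>, so it has a preimage;
  minimality on either side then gives the two inequalities.\<close>

lemma map_emv_neg:
  assumes "emv_idem a" "x \<le> a"
  shows "f (emv_neg a x) = emv_neg (f a) (f x)"
proof -
  have fa: "emv_idem (f a)" "f x \<le> f a"
    using assms by (simp_all add: map_idem_iff map_le_iff)
  obtain z where z: "emv_neg (f a) (f x) = f z"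
    using down_closed[OF emv_neg_le[OF fa]] by blast
  have "z \<le> a" "x + z = a"
    using emv_neg_le[OF fa] emv_neg_least(1)[OF fa]
    by (simp_all add: z map_le_iff map_eq_iff flip: map_add)
  then have "emv_neg a x \<le> z"
    using emv_neg_least(2)[OF assms] by blast
  moreover have "f z \<le> f (emv_neg a x)"
    unfolding z[symmetric] using assms emv_neg_least(1)[OF assms]
    by (intro emv_neg_least(2)[OF fa]) (simp_all add: map_le_iff emv_neg_le flip: map_add)
  ultimately show ?thesis
    by (simp add: z map_le_iff order.antisym)
qed

lemma map_odot: "f (x \<odot> y) = f x \<odot> f y"
proof -
  obtain a where a: "emv_idem a" "sup x y \<le> a"
    using idem_above by blast
  then have le: "x \<le> a" "y \<le> a"
    by auto
  then show ?thesis
    using a(1)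
    by (simp add: emv_odot_eq[of a] emv_odot_eq[of "f a"] map_idem_iff map_le_iff map_emv_neg map_add
        emv_neg_le add_le_idem)
qed

lemma restrict_square_root:
  assumes R: "emv_square_root R" and closed: "R ` range f \<subseteq> range f"
  shows "emv_square_root (inv f \<circ> R \<circ> f)"
proof -
  \<comment> \<open>Closure under \<open>R\<close> puts \<open>R (f x)\<close> in the range, where
    \<open>inv f\<close> is a genuine inverse; both axioms then transfer through
    \<open>f\<close>.\<close>
  have r: "f ((inv f \<circ> R \<circ> f) x) = R (f x)" for x
    unfolding comp_apply using closed by (intro f_inv_into_f) blast
  show ?thesis
    using R unfolding emv_square_root_def
    by (metis r map_odot map_eq_iff map_le_iff)
qed

end

section \<open>The square root preserves the image\<close>

lemma square_root_maps_ideal: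
  fixes I :: "'b::emv_algebra set"
  assumes I: "emv_ideal I" "I \<noteq> UNIV"
    and u: "emv_is_top u" and cover: "\<And>y. y \<in> I \<or> (\<exists>x\<in>I. y = emv_neg u x)"
    and R: "emv_square_root R"
    and x: "x \<in> I"
  shows "R x \<in> I"
proof (rule ccontr)
  assume "R x \<notin> I"
  then obtain y where y: "y \<in> I" "R x = emv_neg u y"
    using cover by blast
  have le_u: "z \<le> u" for z
    using u by (simp add: emv_is_top_def)
  \<comment> \<open>Some idempotent lies above the top, hence equals it, so negation and product may
    be computed in [0,u].\<close>
  obtain a where "emv_idem a" "u \<le> a"
    using idem_above by blast
  then have idem: "emv_idem u"
    using order.antisym[OF le_u] by blast
  have "x = emv_neg u (y + y)"
    using R y(2) emv_odot_eq[OF idem le_u le_u] emv_neg_neg[OF idem le_u]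
    unfolding emv_square_root_def by metis
  then have "(y + y) + x = u"
    using emv_neg_least(1)[OF idem le_u] by simp
  then have "u \<in> I"
    using I(1) x y(1) unfolding emv_ideal_def by metis
  then have "I = UNIV"
    using I(1) le_u unfolding emv_ideal_def by blast
  with I(2) show False ..
qed

theorem theorem3p8:
  fixes \<iota> :: "'a::emv_algebra \<Rightarrow> 'b::emv_algebra"
    and R :: "'b \<Rightarrow> 'b"
  assumes "representing_emv \<iota>"
    and "emv_square_root R"
  shows "R ` range \<iota> \<subseteq> range \<iota> \<and> emv_square_root (inv \<iota> \<circ> R \<circ> \<iota>)"
proof -
  have emb: "emv_embedding \<iota>"
    using assms(1) by (simp add: representing_emv_def)
  \<comment> \<open>The image is downward closed in both cases, being either the whole codomain or
    an ideal.\<close>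
  have "R ` range \<iota> \<subseteq> range \<iota> \<and> emv_ideal_embedding \<iota>"
  proof (cases "\<exists>t::'a. emv_is_top t")
    case True
    then have "range \<iota> = UNIV"
      using assms(1) by (simp add: representing_emv_def)
    then show ?thesis
      using emb by (simp add: emv_ideal_embedding_def)
  next
    case False
    then obtain u :: 'b where I: "emv_ideal (range \<iota>)" "range \<iota> \<noteq> UNIV" and u: "emv_is_top u"
      and cover: "\<And>y. y \<in> range \<iota> \<or> (\<exists>x. y = emv_neg u (\<iota> x))"
      using assms(1) by (auto simp: representing_emv_def emv_maximal_ideal_def)
    have "R ` range \<iota> \<subseteq> range \<iota>"
      using square_root_maps_ideal[OF I u _ assms(2)] cover by blast
    moreover have "emv_ideal_embedding \<iota>"
      using emb I(1) unfolding emv_ideal_embedding_def emv_ideal_def by blast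
    ultimately show ?thesis ..
  qed
  then show ?thesis
    using emv_ideal_embedding.restrict_square_root[OF _ assms(2)] by blast
qed

end
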